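(* For each $k\in\mathbb{N}$, there are (up to isomorphism) only finitely many $k$-vertex-critical (co-gem, dart)-free graphs.
   Context: All graphs are finite, simple and undirected; $\mathbb{N}=\{1,2,3,\ldots\}$. A graph $G$ is $k$-vertex-critical if $\chi(G)=k$ and $\chi(G-v)<k$ for all $v\in V(G)$, where $\chi$ is the chromatic number. A graph is $(H_1,H_2)$-free if it contains neither $H_1$ nor $H_2$ as an induced subgraph. The co-gem is $P_4+P_1$, the disjoint union of a chordless path on four vertices and an isolated vertex. The dart is the five-vertex graph with vertices $a,b,c,d,p$ and edges $ab, ac, bc, bd, cd, bp$ (a diamond, i.e. $K_4$ minus an edge, with a pendant vertex attached to one of its degree-3 vertices). *)

theory Defs
  imports "Graph_Theory.Graph_Theory"
begin

text \<open>
  Finite simple undirected graphs are the symmetric digraphs of the locale \<^locale>\<open>graph\<close>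
  (finite, no loops, no parallel arcs): an edge $uv$ is the pair of opposite arcs between
  $u$ and $v$, so \<^const>\<open>arcs_ends\<close> is the adjacency relation. The graph without vertices is
  allowed.
\<close>

definition proper_colouring :: "('a,'b) pre_digraph \<Rightarrow> nat \<Rightarrow> ('a \<Rightarrow> nat) \<Rightarrow> bool" where
  "proper_colouring G k c \<longleftrightarrow>
     (\<forall>v \<in> verts G. c v < k) \<and> (\<forall>(u, v) \<in> arcs_ends G. c u \<noteq> c v)"

text \<open>Only meaningful for loop-free digraphs with finitely many vertices, which always have
  a proper colouring.\<close>

definition chromatic_number :: "('a,'b) pre_digraph \<Rightarrow> nat" where
  "chromatic_number G = (LEAST k. \<exists>c. proper_colouring G k c)"

definition vertex_critical :: "nat \<Rightarrow> ('a,'b) pre_digraph \<Rightarrow> bool" where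
  "vertex_critical k G \<longleftrightarrow>
     chromatic_number G = k \<and>
     (\<forall>v \<in> verts G. chromatic_number (pre_digraph.del_vert G v) < k)"

definition induced_free :: "('c,'d) pre_digraph \<Rightarrow> ('a,'b) pre_digraph \<Rightarrow> bool" where
  "induced_free H G \<longleftrightarrow> \<not> (\<exists>G'. induced_subgraph G' G \<and> digraph_iso G' H)"

text \<open>In both graphs every edge is listed in one direction only;
  \<^const>\<open>mk_symmetric\<close> adds the opposite arcs.\<close>

definition co_gem :: "nat pair_pre_digraph" where
  "co_gem = mk_symmetric (with_proj
     \<lparr> pverts = {0, 1, 2, 3, 4}, parcs = {(0, 1), (1, 2), (2, 3)} \<rparr>)"

text \<open>The vertices $a, b, c, d, p$ are $0, 1, 2, 3, 4$: the diamond on $a, b, c, d$ without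
  the edge $ad$, and the pendant vertex $p$ attached to $b$.\<close>

definition dart :: "nat pair_pre_digraph" where
  "dart = mk_symmetric (with_proj
     \<lparr> pverts = {0, 1, 2, 3, 4},
       parcs = {(0, 1), (0, 2), (1, 2), (1, 3), (2, 3), (1, 4)} \<rparr>)"

end

theory Submission
  imports Defs "HOL-Library.Ramsey"
begin

text \<open>
  It suffices to bound the order of the graphs in question. A $k$-vertex-critical graph has no
  clique on $k+1$ vertices, so by Ramsey's theorem it is enough to bound the size of a maximal
  independent set $S$.

  The proof looks at the traces of the vertices outside $S$, that is, at their sets of neighbours
  in $S$; by maximality none is empty. Call a vertex branched if its trace has at least two
  elements. A co-gem or a dart appears unless any two branched traces that intersect are equal or
  cover $S$ (\<open>branched_traces\<close>). The unbranched vertices split into clusters: the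
  cluster of $s \in S$ consists of $s$ and of the vertices with trace $\{s\}$, and different
  clusters are anticomplete to each other once $S$ has three elements.

  Suppose some branched vertex misses two elements of $S$. Then the structure of the traces yields two
  elements of $S$ which no branched trace separates, and whose clusters have the same outer
  neighbours, each complete to both. Of two such clusters, the one with the smaller chromatic number
  can be coloured with the colours of the other, contrary to criticality
  (\<open>branched_misses_at_most_one\<close>).

  So every branched vertex sees all of $S$ except for at most one element. Co-gems now force it to be
  complete to all clusters with at most one exception, and darts force the vertices with exceptional
  cluster $s$, the defect of $s$, to be anticomplete to all other branched vertices. The graph thus
  consists of many clusters and defects joined in a uniform way. If three elements of $S$ agree in
  the chromatic numbers of cluster and defect, the palettes of one cluster and of one
  defect suffice for all three, again contrary to criticality (\<open>no_three_alike\<close>). As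
  these chromatic numbers are less than $k$, the pigeonhole principle bounds the size of $S$.
\<close>

section \<open>Colourings of vertex sets\<close>

definition proper_on :: "('a \<Rightarrow> 'a \<Rightarrow> bool) \<Rightarrow> 'a set \<Rightarrow> ('a \<Rightarrow> nat) \<Rightarrow> bool" where
  "proper_on E A c \<longleftrightarrow> (\<forall>u \<in> A. \<forall>v \<in> A. E u v \<longrightarrow> c u \<noteq> c v)"

definition colourable :: "('a \<Rightarrow> 'a \<Rightarrow> bool) \<Rightarrow> 'a set \<Rightarrow> nat \<Rightarrow> bool" where
  "colourable E A m \<longleftrightarrow> (\<exists>c. proper_on E A c \<and> c ` A \<subseteq> {..<m})"

definition chi :: "('a \<Rightarrow> 'a \<Rightarrow> bool) \<Rightarrow> 'a set \<Rightarrow> nat" where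
  "chi E A = (LEAST m. colourable E A m)"

lemma proper_onD: "proper_on E A c \<Longrightarrow> u \<in> A \<Longrightarrow> v \<in> A \<Longrightarrow> E u v \<Longrightarrow> c u \<noteq> c v"
  by (auto simp: proper_on_def)

lemma proper_on_mono: "proper_on E B c \<Longrightarrow> A \<subseteq> B \<Longrightarrow> proper_on E A c"
  by (auto simp: proper_on_def)

lemma colourable_mono: "colourable E B m \<Longrightarrow> A \<subseteq> B \<Longrightarrow> colourable E A m"
  unfolding colourable_def proper_on_def by (meson image_mono subset_trans subsetD)

lemma chi_le: "colourable E A m \<Longrightarrow> chi E A \<le> m"
  unfolding chi_def by (rule Least_le)

lemma colourable_card_colours:
  assumes "finite A" "proper_on E A c"
  shows "colourable E A (card (c ` A))"
proof -
  obtain h where h: "bij_betw h (c ` A) {..<card (c ` A)}"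
    using ex_bij_betw_finite_nat[of "c ` A"] assms(1) by (auto simp: atLeast0LessThan)
  have "inj_on h (c ` A)" "h ` c ` A = {..<card (c ` A)}"
    using h by (auto simp: bij_betw_def)
  then have "proper_on E A (h \<circ> c)" "(h \<circ> c) ` A \<subseteq> {..<card (c ` A)}"
    using assms(2) by (auto simp: proper_on_def inj_on_eq_iff image_comp)
  then show ?thesis unfolding colourable_def by blast
qed

text \<open>
  The recolouring step behind both arguments from criticality: a proper colouring of \<^term>\<open>B\<close>
  shows at least \<^term>\<open>chi E B\<close> colours, hence enough of them to colour any set \<^term>\<open>A\<close> of no larger
  chromatic number.
\<close>

lemma recolour:
  assumes fin: "finite A" "finite B" and c: "proper_on E B c"
    and loopfree: "\<And>x. \<not> E x x" and le: "chi E A \<le> chi E B"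
  obtains g where "proper_on E A g" "g ` A \<subseteq> c ` B"
proof -
  obtain i :: "'a \<Rightarrow> nat" where "inj_on i A"
    using finite_imp_inj_to_nat_seg[OF fin(1)] by blast
  then have "proper_on E A i"
    using loopfree by (auto simp: proper_on_def inj_on_def)
  then have "colourable E A (chi E A)"
    unfolding chi_def using colourable_card_colours[OF fin(1)] LeastI by metis
  then obtain a where a: "proper_on E A a" "a ` A \<subseteq> {..<chi E A}"
    unfolding colourable_def by blast
  have "chi E A \<le> card (c ` B)"
    using le chi_le[OF colourable_card_colours[OF fin(2) c]] by linarith
  then have sub: "a ` A \<subseteq> {..<card (c ` B)}"
    using a(2) by auto
  obtain h where h: "bij_betw h {..<card (c ` B)} (c ` B)"
    using ex_bij_betw_nat_finite[of "c ` B"] fin(2) by (auto simp: atLeast0LessThan)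
  have "inj_on h (a ` A)"
    using h sub by (meson bij_betw_def inj_on_subset)
  then have "proper_on E A (h \<circ> a)"
    using a(1) by (auto simp: proper_on_def inj_on_eq_iff)
  moreover have "(h \<circ> a) ` A \<subseteq> c ` B"
    using h sub by (auto simp: bij_betw_def)
  ultimately show ?thesis using that by blast
qed

section \<open>Vertex-critical graphs\<close>

locale simple_graph =
  fixes V :: "'a set" and E :: "'a \<Rightarrow> 'a \<Rightarrow> bool"
  assumes finite_V: "finite V"
    and adj_sym: "E u v \<Longrightarrow> E v u"
    and loopfree: "\<not> E u u"
    and adj_in_V: "E u v \<Longrightarrow> u \<in> V"

text \<open>
  For \<^term>\<open>m = k - 1\<close> these are the $k$-vertex-critical graphs.
\<close>

locale critical_graph = simple_graph +
  fixes m :: nat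
  assumes not_colourable: "\<not> colourable E V m"
    and delete_colourable: "v \<in> V \<Longrightarrow> colourable E (V - {v}) m"
begin

lemma no_recolouring:
  assumes c: "c ` (V - A) \<subseteq> {..<m}"
    and g: "g ` A \<subseteq> c ` (V - A)"
  shows "\<not> proper_on E V (\<lambda>x. if x \<in> A then g x else c x)"
proof -
  have "(\<lambda>x. if x \<in> A then g x else c x) ` V \<subseteq> {..<m}"
    using c g by (auto simp: image_subset_iff)
  then show ?thesis
    using not_colourable unfolding colourable_def by blast
qed

text \<open>
  If every outer neighbour of \<^term>\<open>A\<close> is complete to \<^term>\<open>B\<close>, then the colours seen on \<^term>\<open>B\<close> are
  free for \<^term>\<open>A\<close>, and there are enough of them. So a colouring that omits a vertex of \<^term>\<open>A\<close>
  can be changed on \<^term>\<open>A\<close> into one of the whole graph.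
  For single vertices this is the familiar fact that a critical graph has no two
  non-adjacent vertices with nested neighbourhoods.
\<close>

lemma no_comparable_sets:
  assumes "A \<subseteq> V" "B \<subseteq> V" "A \<noteq> {}" and disj: "A \<inter> B = {}" and le: "chi E A \<le> chi E B"
    and nbrs: "\<And>q x. q \<in> A \<Longrightarrow> x \<notin> A \<Longrightarrow> E q x \<Longrightarrow> x \<notin> B \<and> (\<forall>r \<in> B. E x r)"
  shows False
proof -
  obtain v where v: "v \<in> A" using \<open>A \<noteq> {}\<close> by blast
  then obtain c where c: "proper_on E (V - {v}) c" "c ` (V - {v}) \<subseteq> {..<m}"
    using delete_colourable \<open>A \<subseteq> V\<close> unfolding colourable_def by blast
  have fin: "finite A" "finite B"
    using assms finite_V by (auto intro: finite_subset)
  have "proper_on E B c"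
    using c(1) by (rule proper_on_mono) (use assms v in blast)
  then obtain g where g: "proper_on E A g" "g ` A \<subseteq> c ` B"
    using recolour[OF fin _ loopfree le] by blast
  have cross: "g x \<noteq> c y" if "x \<in> A" "y \<in> V" "y \<notin> A" "E x y" for x y
  proof -
    have "g x \<in> c ` B" using g(2) that(1) by (rule subsetD[OF _ imageI])
    then obtain r where r: "r \<in> B" "g x = c r" by (elim imageE)
    have "E y r" using nbrs[OF that(1,3,4)] r(1) by blast
    moreover have "y \<in> V - {v}" "r \<in> V - {v}"
      using that r v disj \<open>B \<subseteq> V\<close> by blast+
    ultimately show ?thesis
      using proper_onD[OF c(1)] r(2) by metis
  qed
  have "proper_on E V (\<lambda>x. if x \<in> A then g x else c x)"
    unfolding proper_on_def
  proof (intro ballI impI)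
    fix x y assume xy: "x \<in> V" "y \<in> V" "E x y"
    consider "x \<in> A" "y \<in> A" | "x \<in> A" "y \<notin> A" | "x \<notin> A" "y \<in> A" | "x \<notin> A" "y \<notin> A" by blast
    then show "(if x \<in> A then g x else c x) \<noteq> (if y \<in> A then g y else c y)"
    proof cases
      case 1 then show ?thesis using proper_onD[OF g(1)] xy by simp
    next
      case 2 then show ?thesis using cross xy by simp
    next
      case 3 then show ?thesis using cross[of y x] adj_sym xy by auto
    next
      case 4
      then have "x \<in> V - {v}" "y \<in> V - {v}" using v xy by auto
      then show ?thesis using proper_onD[OF c(1)] xy 4 by simp
    qed
  qed
  moreover have "c ` (V - A) \<subseteq> {..<m}" "g ` A \<subseteq> c ` (V - A)"
    using c(2) v g(2) disj \<open>B \<subseteq> V\<close> by blast+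
  ultimately show False using no_recolouring by blast
qed

end

section \<open>Traces on a maximal independent set\<close>

text \<open>
  Adjacency and non-adjacency along the path $a,b,c,d$ force the five vertices of a
  co-gem to be distinct. In a dart the only coincidence left open is between the two
  non-adjacent vertices $a,d$ of the diamond.
\<close>

locale co_gem_dart_free = simple_graph +
  assumes no_co_gem: "\<lbrakk>E a b; E b c; E c d; \<not> E a c; \<not> E a d; \<not> E b d;
      z \<in> V; \<not> E z a; \<not> E z b; \<not> E z c; \<not> E z d\<rbrakk> \<Longrightarrow> False"
    and no_dart: "\<lbrakk>E a b; E a c; E b c; E b d; E c d; E b p;
      a \<noteq> d; \<not> E a d; \<not> E p a; \<not> E p c; \<not> E p d\<rbrakk> \<Longrightarrow> False"

locale maximal_independent = co_gem_dart_free +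
  fixes S :: "'a set"
  assumes S_sub: "S \<subseteq> V"
    and S_indep: "s \<in> S \<Longrightarrow> t \<in> S \<Longrightarrow> \<not> E s t"
    and S_dom: "x \<in> V \<Longrightarrow> x \<notin> S \<Longrightarrow> \<exists>s \<in> S. E x s"
begin

definition trace :: "'a \<Rightarrow> 'a set" where
  "trace x = {s \<in> S. E x s}"

definition branched :: "'a set" where
  "branched = {x \<in> V - S. \<exists>s t. s \<in> trace x \<and> t \<in> trace x \<and> s \<noteq> t}"

definition cluster :: "'a \<Rightarrow> 'a set" where
  "cluster s = insert s {x \<in> V - S. trace x = {s}}"

lemma traceD: "a \<in> trace x \<Longrightarrow> a \<in> S \<and> a \<in> V \<and> E x a \<and> E a x"
  using S_sub adj_sym by (auto simp: trace_def)

lemma not_traceD: "a \<notin> trace x \<Longrightarrow> a \<in> S \<Longrightarrow> \<not> E x a \<and> \<not> E a x"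
  using adj_sym by (auto simp: trace_def)

text \<open>
  Two common neighbours $s,t$ in \<^term>\<open>S\<close> form a diamond with the edge $xy$; a further neighbour in
  \<^term>\<open>S\<close> of just one end of $xy$ would complete it to a dart.
\<close>

lemma adj_trace_eq:
  assumes "E x y" "s \<in> trace x" "t \<in> trace x" "s \<in> trace y" "t \<in> trace y" "s \<noteq> t"
  shows "trace x = trace y"
proof -
  have *: "trace x \<subseteq> trace y"
    if "E x y" "s \<in> trace x" "t \<in> trace x" "s \<in> trace y" "t \<in> trace y" for x y
  proof
    fix a assume a: "a \<in> trace x"
    show "a \<in> trace y"
    proof (rule ccontr)
      assume na: "a \<notin> trace y"
      note adj = that(1) traceD[OF that(2)] traceD[OF that(3)] traceD[OF that(4)] traceD[OF that(5)]
        traceD[OF a] not_traceD[OF na]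
      show False
        by (rule no_dart[of s x y t a]) (use adj \<open>s \<noteq> t\<close> S_indep in blast)+
    qed
  qed
  show ?thesis using *[of x y] *[of y x] assms adj_sym by blast
qed

text \<open>
  Suppose that $z \in S$ lies in neither trace, that $s$ lies in both, and that $a$ lies in the trace of $x$
  only. The path $a,x,s,y$ and $z$ would form a co-gem, so $x$ and $y$ are adjacent. An element $b$ in the
  trace of $y$ only would give the co-gem on $a,x,y,b$ and $z$, so the trace of $y$ is contained in that of
  $x$. But then the edge $xy$ has two common neighbours in \<^term>\<open>S\<close>, which contradicts
  \<open>adj_trace_eq\<close>.
\<close>

lemma branched_traces:
  assumes x: "x \<in> branched" and y: "y \<in> branched"
    and meet: "trace x \<inter> trace y \<noteq> {}"
  shows "trace x = trace y \<or> trace x \<union> trace y = S"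
proof -
  have *: "trace x \<subseteq> trace y"
    if x: "x \<in> branched" and y: "y \<in> branched"
      and meet: "trace x \<inter> trace y \<noteq> {}" and ncov: "trace x \<union> trace y \<noteq> S" for x y
  proof
    fix a assume a: "a \<in> trace x"
    obtain z where z: "z \<in> S" "z \<notin> trace x" "z \<notin> trace y"
      using ncov traceD by blast
    note zn = not_traceD[OF z(2,1)] not_traceD[OF z(3,1)]
    have zV: "z \<in> V" using z S_sub by blast
    obtain s where s: "s \<in> trace x" "s \<in> trace y"
      using meet by blast
    show "a \<in> trace y"
    proof (rule ccontr)
      assume na: "a \<notin> trace y"
      note adj = traceD[OF a] traceD[OF s(1)] traceD[OF s(2)] not_traceD[OF na] zn zV
      have xy: "E x y"
      proof (rule ccontr)
        assume "\<not> E x y"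
        then show False
          using no_co_gem[of a x s y z] adj z S_indep by blast
      qed
      have sub: "trace y \<subseteq> trace x"
      proof
        fix b assume b: "b \<in> trace y"
        show "b \<in> trace x"
        proof (rule ccontr)
          assume nb: "b \<notin> trace x"
          show False
            by (rule no_co_gem[of a x y b z])
              (use adj z xy traceD[OF b] not_traceD[OF nb] S_indep in blast)+
        qed
      qed
      obtain s' t' where "s' \<in> trace y" "t' \<in> trace y" "s' \<noteq> t'"
        using y by (auto simp: branched_def)
      then have "trace x = trace y"
        using adj_trace_eq[OF xy] sub by blast
      then show False using a na by blast
    qed
  qed
  show ?thesis using *[of x y] *[of y x] x y meet by blast
qed

lemma cluster_sub: "s \<in> S \<Longrightarrow> cluster s \<subseteq> V"
  using S_sub by (auto simp: cluster_def)

lemma self_in_cluster [simp]: "s \<in> cluster s"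
  by (simp add: cluster_def)

lemma cluster_not_adj: "s \<in> S \<Longrightarrow> t \<in> S \<Longrightarrow> s \<noteq> t \<Longrightarrow> q \<in> cluster s \<Longrightarrow> \<not> E q t \<and> \<not> E t q"
  using S_indep[of s t] S_indep[of t s] not_traceD[of t q] by (auto simp: cluster_def)

lemma cluster_self_adj: "q \<in> cluster s \<Longrightarrow> q \<noteq> s \<Longrightarrow> E q s \<and> E s q"
  using traceD[of s q] by (auto simp: cluster_def)

lemma cluster_disjoint: "s \<in> S \<Longrightarrow> t \<in> S \<Longrightarrow> s \<noteq> t \<Longrightarrow> cluster s \<inter> cluster t = {}"
  by (auto simp: cluster_def)

lemma cluster_or_branched:
  assumes "x \<in> V"
  shows "(\<exists>s \<in> S. x \<in> cluster s) \<or> x \<in> branched"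
proof (cases "x \<in> S")
  case False
  then obtain s where s: "s \<in> trace x" using S_dom assms by (auto simp: trace_def)
  have "x \<in> branched \<or> trace x = {s}"
    using False assms s by (auto simp: branched_def)
  then show ?thesis
    using False assms traceD[OF s] by (auto simp: cluster_def)
qed (auto simp: cluster_def)

lemma branched_not_cluster: "x \<in> branched \<Longrightarrow> s \<in> S \<Longrightarrow> x \<notin> cluster s"
  by (auto simp: branched_def cluster_def)

text \<open>
  An edge $qr$ between two clusters would extend to the path $s,q,r,t$, and any third vertex
  of \<^term>\<open>S\<close> would complete a co-gem.
\<close>

lemma cluster_anticomplete:
  assumes "s \<in> S" "t \<in> S" "u \<in> S" "s \<noteq> t" "u \<noteq> s" "u \<noteq> t" "q \<in> cluster s" "r \<in> cluster t"
  shows "\<not> E q r"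
proof
  assume qr: "E q r"
  have qt: "\<not> E q t \<and> \<not> E t q" and rs: "\<not> E r s \<and> \<not> E s r"
    and qu: "\<not> E q u \<and> \<not> E u q" and ru: "\<not> E r u \<and> \<not> E u r"
    using cluster_not_adj assms by blast+
  then have "q \<noteq> s" "r \<noteq> t" using qr adj_sym by blast+
  then have "E s q" "E r t" using cluster_self_adj assms by blast+
  moreover have "\<not> E s t" "\<not> E u s" "\<not> E u t" "u \<in> V"
    using S_indep S_sub assms by auto
  ultimately show False
    using no_co_gem[of s q r t u] qr qt rs qu ru by blast
qed

text \<open>
  When no branched trace separates $s$ from $t$, and some branched vertex $w$ sees neither, the
  cluster of $t$ has at least the outer neighbours of the cluster of $s$, as
  \<open>no_comparable_sets\<close> requires. The vertex $w$ is needed for those $x$ that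
  see all of \<^term>\<open>S\<close>: there it serves as the isolated vertex of the co-gem.
\<close>

lemma cluster_outer_neighbour:
  assumes st: "s \<in> S" "t \<in> S" "s \<noteq> t"
    and w: "w \<in> branched" "s \<notin> trace w" "t \<notin> trace w"
    and unsep: "\<And>x. x \<in> branched \<Longrightarrow> s \<in> trace x \<longleftrightarrow> t \<in> trace x"
    and q: "q \<in> cluster s" and x: "x \<notin> cluster s" "E q x"
  shows "x \<in> branched \<and> (\<forall>r \<in> cluster t. E x r)"
proof -
  obtain a b where ab: "a \<in> trace w" "b \<in> trace w" "a \<noteq> b"
    using w(1) by (auto simp: branched_def)
  have a: "a \<in> S" "a \<noteq> s" "a \<noteq> t" using ab w traceD by blast+
  have "x \<notin> cluster u" if u: "u \<in> S" for u
  proof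
    assume xu: "x \<in> cluster u"
    then have "u \<noteq> s" using x by blast
    moreover have "\<exists>z \<in> S. z \<noteq> s \<and> z \<noteq> u" using a st by metis
    ultimately show False using cluster_anticomplete[of s u _ q x] u st q xu x by metis
  qed
  then have xb: "x \<in> branched"
    using cluster_or_branched adj_in_V adj_sym x(2) by blast
  have s_x: "s \<in> trace x"
  proof (rule ccontr)
    assume ns: "s \<notin> trace x"
    then have nt: "t \<notin> trace x" using unsep xb by blast
    obtain c where c: "c \<in> trace x" using xb by (auto simp: branched_def)
    have cS: "c \<in> S" "c \<noteq> s" "c \<noteq> t" using c ns nt traceD by blast+
    note n = not_traceD[OF ns st(1)] not_traceD[OF nt st(2)] traceD[OF c]
    have qs: "E q s \<and> E s q" using cluster_self_adj q n x(2) by blast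
    have "\<not> E q c \<and> \<not> E c q" "\<not> E q t \<and> \<not> E t q" "\<not> E s c" "\<not> E t s" "\<not> E t c" "t \<in> V"
      using cluster_not_adj q st cS S_indep S_sub by blast+
    then show False using no_co_gem[of s q x c t] n qs x(2) by blast
  qed
  then have t_x: "t \<in> trace x" using unsep xb by blast
  have "E x r" if r: "r \<in> cluster t" for r
  proof (rule ccontr)
    assume xr: "\<not> E x r"
    then have rx: "\<not> E r x" using adj_sym by blast
    note n = traceD[OF s_x] traceD[OF t_x]
    have rt: "E r t \<and> E t r" using cluster_self_adj r n xr by blast
    have rs: "\<not> E r s \<and> \<not> E s r" "\<not> E t s" using cluster_not_adj r st S_indep by blast+
    \<comment> \<open>The path $r,t,x,s$ leaves only the isolated vertex of a co-gem to be found.\<close>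
    have *: False if z: "z \<in> V" "\<not> E z r" "\<not> E z t" "\<not> E z x" "\<not> E z s" for z
      using no_co_gem[of r t x s z] z rt n rx rs by blast
    show False
    proof (cases "trace x = S")
      case False
      then obtain z where z: "z \<in> S" "z \<notin> trace x" using traceD by blast
      then have "z \<noteq> t" using t_x by blast
      then have "\<not> E z r" "\<not> E z t" "\<not> E z s" "z \<in> V"
        using cluster_not_adj[of t z r] z st r S_indep S_sub by blast+
      then show False using * not_traceD[OF z(2,1)] by blast
    next
      case True
      note nw = not_traceD[OF w(2) st(1)] not_traceD[OF w(3) st(2)] traceD[OF ab(1)]
      have wx: "\<not> E w x"
      proof
        assume "E w x"
        then have "trace w = trace x"
          using adj_trace_eq[of w x a b] ab True traceD by blast
        then show False using w s_x by blast
      qed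
      have wr: "\<not> E w r"
      proof
        assume "E w r"
        then have "E r w" using adj_sym by blast
        moreover have "\<not> E r a" "\<not> E t a" "\<not> E s t" "\<not> E s a" "s \<in> V"
          using cluster_not_adj[of t a r] a st r S_indep S_sub by blast+
        ultimately show False
          using no_co_gem[of t r w a s] rt nw rs by blast
      qed
      show False using * wx wr nw w(1) by (auto simp: branched_def)
    qed
  qed
  then show ?thesis using xb by blast
qed

text \<open>
  A branched trace that separates $s$ from $t$ cannot meet the trace of $w$: it would have to equal it
  or to cover \<^term>\<open>S\<close> together with it, and neither allows it to contain just one of $s,t$.
  No two vertices of such a disjoint trace can then be separated by a third trace.
\<close>

lemma ex_unseparated:
  assumes w: "w \<in> branched" and st: "s \<in> S" "t \<in> S" "s \<noteq> t" "s \<notin> trace w" "t \<notin> trace w"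
  obtains a b where "a \<in> S" "b \<in> S" "a \<noteq> b" "a \<notin> trace w" "b \<notin> trace w"
    "\<And>y. y \<in> branched \<Longrightarrow> a \<in> trace y \<longleftrightarrow> b \<in> trace y"
proof (cases "\<forall>y \<in> branched. s \<in> trace y \<longleftrightarrow> t \<in> trace y")
  case True
  then show ?thesis using that st by blast
next
  case False
  then obtain x where x: "x \<in> branched" and sep: "s \<in> trace x \<longleftrightarrow> t \<notin> trace x" by blast
  have disj: "trace x \<inter> trace w = {}"
  proof (rule ccontr)
    assume "trace x \<inter> trace w \<noteq> {}"
    from branched_traces[OF x w this] show False using sep st by blast
  qed
  obtain a b where ab: "a \<in> trace x" "b \<in> trace x" "a \<noteq> b"
    using x by (auto simp: branched_def)
  obtain c where c: "c \<in> trace w" using w by (auto simp: branched_def)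
  have *: "b' \<in> trace y"
    if y: "y \<in> branched" "a' \<in> trace y" and ab': "a' \<in> trace x" "b' \<in> trace x" for y a' b'
  proof (rule ccontr)
    assume nb: "b' \<notin> trace y"
    have "trace y \<union> trace x = S"
      using branched_traces[OF y(1) x] y ab' nb by blast
    then have "c \<in> trace y" using c disj traceD by blast
    then have "trace y = trace w \<or> trace y \<union> trace w = S"
      using branched_traces[OF y(1) w] c by blast
    then show False
      using nb y ab' disj traceD by blast
  qed
  show ?thesis
    by (rule that[of a b]) (use ab disj * traceD in blast)+
qed

end

section \<open>Branched vertices miss at most one vertex of the independent set\<close>

locale critical_co_gem_dart_free = critical_graph + maximal_independent
begin

text \<open>
  Otherwise \<open>ex_unseparated\<close> provides two elements of \<^term>\<open>S\<close> whose clusters satisfy the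
  hypothesis of \<open>no_comparable_sets\<close> on neighbours in both directions, so that one of the two
  clusters can be recoloured after the other.
\<close>

lemma branched_misses_at_most_one:
  assumes w: "w \<in> branched" and st: "s \<in> S" "t \<in> S" "s \<noteq> t"
  shows "s \<in> trace w \<or> t \<in> trace w"
proof (rule ccontr)
  assume "\<not> ?thesis"
  then obtain a b where ab: "a \<in> S" "b \<in> S" "a \<noteq> b" "a \<notin> trace w" "b \<notin> trace w"
    and unsep: "\<And>y. y \<in> branched \<Longrightarrow> a \<in> trace y \<longleftrightarrow> b \<in> trace y"
    using ex_unseparated[OF w st] by blast
  \<comment> \<open>The hypotheses are symmetric in the two vertices, so their clusters are excluded from being
    comparable in either order.\<close>
  have *: "\<not> chi E (cluster a') \<le> chi E (cluster b')"
    if "a' \<in> S" "b' \<in> S" "a' \<noteq> b'" "a' \<notin> trace w" "b' \<notin> trace w"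
      "\<And>y. y \<in> branched \<Longrightarrow> a' \<in> trace y \<longleftrightarrow> b' \<in> trace y" for a' b'
  proof
    assume le: "chi E (cluster a') \<le> chi E (cluster b')"
    show False
    proof (rule no_comparable_sets[of "cluster a'" "cluster b'"])
      show "x \<notin> cluster b' \<and> (\<forall>r \<in> cluster b'. E x r)" if "q \<in> cluster a'" "x \<notin> cluster a'" "E q x" for q x
        using cluster_outer_neighbour[OF \<open>a' \<in> S\<close> \<open>b' \<in> S\<close> \<open>a' \<noteq> b'\<close> w] that
          \<open>a' \<notin> trace w\<close> \<open>b' \<notin> trace w\<close> \<open>\<And>y. y \<in> branched \<Longrightarrow> a' \<in> trace y \<longleftrightarrow> b' \<in> trace y\<close>
          branched_not_cluster \<open>b' \<in> S\<close> by blast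
    qed (use that le cluster_sub cluster_disjoint self_in_cluster in blast)+
  qed
  show False
    using *[of a b] *[of b a] ab unsep by (metis linear)
qed

section \<open>Bounding the independent set\<close>

text \<open>
  By \<open>complete_to_all_but_one\<close>, once \<^term>\<open>S\<close> has four elements,
  a branched vertex lies in the defect of at most one
  \<^term>\<open>s \<in> S\<close>. So the defects partition the branched vertices, apart from those that are complete
  to all clusters.
\<close>

definition defect :: "'a \<Rightarrow> 'a set" where
  "defect s = {x \<in> branched. \<exists>q \<in> cluster s. \<not> E x q}"

lemma defect_sub: "defect s \<subseteq> V"
  by (auto simp: defect_def branched_def)

lemma ex_fresh:
  assumes "4 \<le> card S"
  obtains u where "u \<in> S" "u \<noteq> a" "u \<noteq> b" "u \<noteq> c"
proof -
  have "\<not> S \<subseteq> {a, b, c}"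
    using card_mono[of "{a, b, c}" S] card_insert_le_m1[of 3 "{b, c}" a] assms
    by (auto simp: card_insert_if split: if_splits)
  then show ?thesis using that by blast
qed

text \<open>
  If \<^term>\<open>x\<close> misses both \<^term>\<open>q\<close> and \<^term>\<open>r\<close>, it still sees one of the centres, say \<^term>\<open>t\<close>, and a third
  $u \in S$. Then the path $r,t,x,u$ and the vertex \<^term>\<open>q\<close> form a co-gem.
\<close>

lemma complete_to_all_but_one:
  assumes card: "4 \<le> card S" and x: "x \<in> branched"
    and st: "s \<in> S" "t \<in> S" "s \<noteq> t" and q: "q \<in> cluster s" "\<not> E x q" and r: "r \<in> cluster t"
  shows "E x r"
proof (rule ccontr)
  assume xr: "\<not> E x r"
  have *: False
    if st: "s \<in> S" "t \<in> S" "s \<noteq> t" and q: "q \<in> cluster s" "\<not> E x q" and r: "r \<in> cluster t" "\<not> E x r"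
      and t: "t \<in> trace x" for s t q r
  proof -
    \<comment> \<open>Two candidates besides $s,t$ are available, and $x$ misses at most one of them.\<close>
    obtain u where u: "u \<in> trace x" "u \<noteq> s" "u \<noteq> t"
      using ex_fresh[OF card, of s t t] ex_fresh[OF card, of s t]
        branched_misses_at_most_one[OF x] by metis
    note n = traceD[OF t] traceD[OF u(1)]
    have "\<not> E q x" "\<not> E r x" using q r adj_sym by blast+
    moreover have "E r t \<and> E t r" using cluster_self_adj r n by blast
    moreover have "\<not> E q r" using cluster_anticomplete[of s t u q r] st u n q r by blast
    moreover have "\<not> E r u" "\<not> E q t" "\<not> E q u" "\<not> E t u" "q \<in> V"
      using cluster_not_adj[of t u r] cluster_not_adj[of s t q] cluster_not_adj[of s u q] st u n q r S_indep cluster_sub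
      by blast+
    ultimately show False
      using no_co_gem[of r t x u q] n by blast
  qed
  show False
    using *[of s t q r] *[of t s r q] branched_misses_at_most_one[OF x st] st q r xr by blast
qed

lemma defectD: "x \<in> defect s \<Longrightarrow> x \<in> branched"
  by (simp add: defect_def)

lemma defect_complete:
  assumes "4 \<le> card S" "x \<in> defect s" "s \<in> S" "t \<in> S" "s \<noteq> t" "r \<in> cluster t"
  shows "E x r"
  using complete_to_all_but_one[OF assms(1)] assms(2-) unfolding defect_def by blast

text \<open>
  Let $x$ miss $q$ in the cluster of $s$, while $y$ is complete to that cluster. If $x$ and $y$
  were adjacent, two common neighbours $u,v$ in \<^term>\<open>S\<close> would form a diamond with them, and $q$
  would be a pendant vertex at $y$: a dart.
\<close>

lemma defect_anticomplete:
  assumes card: "4 \<le> card S" and s: "s \<in> S" and x: "x \<in> defect s"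
    and y: "y \<in> branched" "y \<notin> defect s"
  shows "\<not> E x y"
proof
  assume xy: "E x y"
  obtain q where q: "q \<in> cluster s" "\<not> E x q" using x by (auto simp: defect_def)
  have yq: "E y q" using y q by (auto simp: defect_def)
  obtain a where a: "a \<in> S" "a \<noteq> s" using ex_fresh[OF card, of s s s] by blast
  obtain b where b: "b \<in> S" "b \<noteq> s" "b \<noteq> a" using ex_fresh[OF card, of s a a] by blast
  obtain c where c: "c \<in> S" "c \<noteq> s" "c \<noteq> a" "c \<noteq> b" using ex_fresh[OF card, of s a b] by blast
  obtain u v where uv: "u \<in> trace y" "v \<in> trace y" "u \<noteq> v" "u \<noteq> s" "v \<noteq> s"
    using a b c branched_misses_at_most_one[OF y(1)] by metis
  note n = traceD[OF uv(1)] traceD[OF uv(2)]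
  have "E x u" "E x v"
    using defect_complete[OF card x s _ _ self_in_cluster] n uv by blast+
  moreover have "E u x" using \<open>E x u\<close> adj_sym by blast
  moreover have "E y x" using xy adj_sym by blast
  moreover have "\<not> E u v" "\<not> E q u" "\<not> E q v" "\<not> E q x"
    using S_indep n cluster_not_adj[of s u q] cluster_not_adj[of s v q] uv s q adj_sym by blast+
  ultimately show False
    using no_dart[of u y x v q] n uv(3) yq by blast
qed

text \<open>
  Colour the graph without $f$ and modify the colouring on the clusters and defects of $d,e,f$:
  the three defects use only colours seen on the defect of $d$, and the three clusters only colours
  seen on the cluster of $e$. No edge gets equal ends: between branched vertices, and between vertices
  of clusters, edges stay inside one recoloured set or outside all of them. For an edge between a cluster and
  a branched vertex, note that the defect of $d$ is complete to every cluster other than that of $d$, and that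
  the branched vertices outside the defects of $e$ and $f$ are complete to the cluster of $e$; hence the two
  colours also occur at the ends of an edge on which the given colouring is proper. The two palettes
  have to come from different indices, since a defect and its own cluster may be joined arbitrarily.
\<close>

lemma no_three_alike:
  assumes card: "4 \<le> card S"
    and S: "d \<in> S" "e \<in> S" "f \<in> S" and dist: "d \<noteq> e" "d \<noteq> f" "e \<noteq> f"
    and Q: "chi E (cluster d) \<le> chi E (cluster e)" "chi E (cluster f) \<le> chi E (cluster e)"
    and D: "chi E (defect e) \<le> chi E (defect d)" "chi E (defect f) \<le> chi E (defect d)"
  shows False
proof -
  have fV: "f \<in> V" using S S_sub by blast
  obtain c where c: "proper_on E (V - {f}) c" "c ` (V - {f}) \<subseteq> {..<m}"
    using delete_colourable[OF fV] unfolding colourable_def by blast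
  have finQ: "finite (cluster s)" if "s \<in> S" for s
    using cluster_sub[OF that] finite_V by (rule finite_subset)
  have finD: "finite (defect s)" for s
    using defect_sub finite_V by (rule finite_subset)
  have cluster_minus: "cluster s \<subseteq> V - {f}" if "s \<in> S" "s \<noteq> f" for s
    using cluster_sub[OF that(1)] cluster_disjoint[of s f] that S self_in_cluster by blast
  have branched_minus: "branched \<subseteq> V - {f}"
    using S by (auto simp: branched_def)
  have D_minus: "defect s \<subseteq> V - {f}" for s
    using branched_minus defectD by blast
  have cQe: "proper_on E (cluster e) c"
    using c(1) cluster_minus[of e] S dist by (blast intro: proper_on_mono)
  have cDd: "proper_on E (defect d) c"
    using c(1) D_minus by (rule proper_on_mono)
  obtain gd where gd: "proper_on E (cluster d) gd" "gd ` cluster d \<subseteq> c ` cluster e"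
    using recolour[OF finQ finQ cQe loopfree Q(1)] S by blast
  obtain gf where gf: "proper_on E (cluster f) gf" "gf ` cluster f \<subseteq> c ` cluster e"
    using recolour[OF finQ finQ cQe loopfree Q(2)] S by blast
  obtain he where he: "proper_on E (defect e) he" "he ` defect e \<subseteq> c ` defect d"
    using recolour[OF finD finD cDd loopfree D(1)] by blast
  obtain hf where hf: "proper_on E (defect f) hf" "hf ` defect f \<subseteq> c ` defect d"
    using recolour[OF finD finD cDd loopfree D(2)] by blast
  define A where "A = cluster d \<union> cluster f \<union> defect e \<union> defect f"
  define g where "g x = (if x \<in> cluster d then gd x else if x \<in> cluster f then gf x
    else if x \<in> defect e then he x else hf x)" for x
  define c' where "c' x = (if x \<in> A then g x else c x)" for x
  have Qdf: "cluster d \<inter> cluster f = {}" using cluster_disjoint S dist by blast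
  have DQ: "x \<notin> cluster s" if "x \<in> branched" "s \<in> S" for x s
    using branched_not_cluster that by blast
  have Def: "x \<notin> defect f" if "x \<in> defect e" for x
  proof
    assume "x \<in> defect f"
    then obtain q where "q \<in> cluster f" "\<not> E x q" by (auto simp: defect_def)
    then show False using defect_complete[OF card that] S dist by blast
  qed
  have c'd: "c' x = gd x" if "x \<in> cluster d" for x
    using that by (simp add: c'_def A_def g_def)
  have c'f: "c' x = gf x" if "x \<in> cluster f" for x
    using that Qdf by (auto simp: c'_def A_def g_def)
  have c'Q: "c' x = c x" if "x \<in> cluster s" "s \<in> S" "s \<noteq> d" "s \<noteq> f" for x s
    using that S cluster_disjoint[of s d] cluster_disjoint[of s f] DQ defectD by (auto simp: c'_def A_def)
  have c'De: "c' x = he x" if "x \<in> defect e" for x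
    using that S DQ defectD by (auto simp: c'_def A_def g_def)
  have c'Df: "c' x = hf x" if "x \<in> defect f" for x
    using that S DQ defectD Def by (auto simp: c'_def A_def g_def)
  have c'B: "c' x = c x" if "x \<in> branched" "x \<notin> defect e" "x \<notin> defect f" for x
    using that S DQ by (auto simp: c'_def A_def)
  \<comment> \<open>Every new colour is an old colour of a vertex in one of the two model sets, the cluster
    of $e$ and the defect of $d$.\<close>
  have ex_in_Qe: "\<exists>y \<in> cluster e. c' x = c y" if "x \<in> cluster d \<or> x \<in> cluster f" for x
    using that
  proof
    assume x: "x \<in> cluster d"
    then have "c' x \<in> c ` cluster e" using gd(2) c'd[OF x] by (metis imageI subsetD)
    then show ?thesis by (elim imageE) (rule bexI)
  next
    assume x: "x \<in> cluster f"
    then have "c' x \<in> c ` cluster e" using gf(2) c'f[OF x] by (metis imageI subsetD)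
    then show ?thesis by (elim imageE) (rule bexI)
  qed
  have ex_in_Dd: "\<exists>y \<in> defect d. c' x = c y" if "x \<in> defect e \<or> x \<in> defect f" for x
    using that
  proof
    assume x: "x \<in> defect e"
    then have "c' x \<in> c ` defect d" using he(2) c'De[OF x] by (metis imageI subsetD)
    then show ?thesis by (elim imageE) (rule bexI)
  next
    assume x: "x \<in> defect f"
    then have "c' x \<in> c ` defect d" using hf(2) c'Df[OF x] by (metis imageI subsetD)
    then show ?thesis by (elim imageE) (rule bexI)
  qed
  have QQ: "c' x \<noteq> c' y" if xy: "E x y" "x \<in> cluster s" "s \<in> S" "y \<in> cluster t" "t \<in> S" for x y s t
  proof -
    have "s = t"
    proof (rule ccontr)
      assume "s \<noteq> t"
      moreover obtain u where "u \<in> S" "u \<noteq> s" "u \<noteq> t" using ex_fresh[OF card, of s t t] by blast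
      ultimately show False using cluster_anticomplete[of s t u x y] xy by blast
    qed
    then have y: "y \<in> cluster s" using xy by blast
    consider "s = d" | "s = f" | "s \<noteq> d" "s \<noteq> f" by blast
    then show ?thesis
    proof cases
      case 1
      then show ?thesis using proper_onD[OF gd(1)] xy y c'd by simp
    next
      case 2
      then show ?thesis using proper_onD[OF gf(1)] xy y c'f by simp
    next
      case 3
      then have "x \<in> V - {f}" "y \<in> V - {f}" using cluster_minus[of s] xy y by blast+
      then show ?thesis using proper_onD[OF c(1)] xy y 3 c'Q by simp
    qed
  qed
  \<comment> \<open>The edge $xy$ is compared with an edge $x'y'$ between vertices that kept their colours.\<close>
  have QB: "c' x \<noteq> c' y" if xy: "E x y" "x \<in> cluster s" "s \<in> S" "y \<in> branched" for x y s
  proof -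
    obtain x' s' where x': "x' \<in> cluster s'" "s' \<in> S" "s' \<noteq> f" "s' \<noteq> d" "c' x = c x'"
      and same: "x' = x \<or> s' = e"
    proof (cases "s = d \<or> s = f")
      case True
      then obtain x' where "x' \<in> cluster e" "c' x = c x'" using ex_in_Qe xy by blast
      then show ?thesis using that[of x' e] S dist by blast
    next
      case False
      then show ?thesis using that[of x s] xy c'Q[of x s] by blast
    qed
    obtain y' where y': "y' \<in> branched" "c' y = c y'" and "E y' x'"
    proof (cases "y \<in> defect e \<or> y \<in> defect f")
      case True
      then obtain y' where y': "y' \<in> defect d" "c' y = c y'" using ex_in_Dd by blast
      then have "E y' x'" using defect_complete[OF card y'(1) S(1) x'(2)] x' by blast
      then show ?thesis using that y' defectD by blast
    next
      case False
      have "E y x'"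
        using same
      proof
        assume "x' = x"
        then show ?thesis using xy adj_sym by blast
      next
        assume "s' = e"
        then show ?thesis using False x' xy by (auto simp: defect_def)
      qed
      then show ?thesis using that[of y] False c'B xy by blast
    qed
    moreover have "x' \<in> V - {f}" "y' \<in> V - {f}"
      using cluster_minus[of s'] x' branched_minus y' by blast+
    ultimately show ?thesis
      using proper_onD[OF c(1)] x'(5) y'(2) by metis
  qed
  have BB: "c' x \<noteq> c' y" if xy: "E x y" "x \<in> branched" "y \<in> branched" for x y
  proof -
    have same: "x \<in> defect s \<longleftrightarrow> y \<in> defect s" if "s \<in> S" for s
      using defect_anticomplete[OF card that] xy adj_sym by blast
    consider "x \<in> defect e" | "x \<in> defect f" | "x \<notin> defect e" "x \<notin> defect f" by blast
    then show ?thesis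
    proof cases
      case 1
      then show ?thesis using same[OF S(2)] proper_onD[OF he(1)] xy c'De by simp
    next
      case 2
      then show ?thesis using same[OF S(3)] proper_onD[OF hf(1)] xy c'Df by simp
    next
      case 3
      then have "y \<notin> defect e" "y \<notin> defect f" using same S by blast+
      moreover have "x \<in> V - {f}" "y \<in> V - {f}" using branched_minus xy by blast+
      ultimately show ?thesis using 3 proper_onD[OF c(1)] xy c'B by simp
    qed
  qed
  have "proper_on E V c'"
    unfolding proper_on_def
  proof (intro ballI impI)
    fix x y assume xy: "x \<in> V" "y \<in> V" "E x y"
    then have yx: "E y x" using adj_sym by blast
    show "c' x \<noteq> c' y"
      using cluster_or_branched[OF xy(1)] cluster_or_branched[OF xy(2)] QQ[OF xy(3)] QB[OF xy(3)]
        QB[OF yx] BB[OF xy(3)] by metis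
  qed
  moreover have "c ` (V - A) \<subseteq> {..<m}"
  proof -
    have "f \<in> A" by (simp add: A_def)
    then have "V - A \<subseteq> V - {f}" by blast
    then show ?thesis using c(2) by (meson image_mono subset_trans)
  qed
  moreover have "g ` A \<subseteq> c ` (V - A)"
  proof
    fix k assume "k \<in> g ` A"
    then obtain x where x: "x \<in> A" "k = g x" by (elim imageE)
    then have k: "k = c' x" by (simp add: c'_def)
    have Qe_out: "cluster e \<subseteq> V - A"
      using cluster_sub[of e] cluster_disjoint[of e d] cluster_disjoint[of e f] S dist DQ defectD by (auto simp: A_def)
    have Dd_out: "x \<notin> defect e \<and> x \<notin> defect f" if "x \<in> defect d" for x
      using defect_complete[OF card that S(1)] S dist by (auto simp: defect_def)
    have Dd_out: "defect d \<subseteq> V - A"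
      using Dd_out defect_sub[of d] DQ defectD S by (auto simp: A_def)
    have "x \<in> cluster d \<or> x \<in> cluster f \<or> x \<in> defect e \<or> x \<in> defect f"
      using x by (auto simp: A_def)
    then show "k \<in> c ` (V - A)"
      using ex_in_Qe[of x] ex_in_Dd[of x] k Qe_out Dd_out by (metis imageI subsetD)
  qed
  ultimately show False
    using no_recolouring[of c A g] unfolding c'_def[abs_def] by blast
qed

lemma chi_part_le:
  assumes "A \<subseteq> V" "A \<noteq> V"
  shows "chi E A \<le> m"
proof -
  obtain v where "v \<in> V" "v \<notin> A" using assms by blast
  then show ?thesis
    using colourable_mono[OF delete_colourable] assms(1) by (intro chi_le) blast
qed

text \<open>
  Clusters and defects of the vertices of \<^term>\<open>S\<close> are proper parts of a critical graph, so the pair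
  of their chromatic numbers takes at most $(m+1)^2$ values, and none of them is taken by three
  vertices of \<^term>\<open>S\<close>. The summand $1$ ensures that a larger \<^term>\<open>S\<close> has four elements even for
  $m = 0$.
\<close>

lemma card_independent_le: "card S \<le> 2 * (m + 1)\<^sup>2 + 1"
proof (rule ccontr)
  assume "\<not> ?thesis"
  then have big: "2 * (m + 1)\<^sup>2 + 1 < card S" by simp
  moreover have "1 \<le> (m + 1)\<^sup>2" by simp
  ultimately have card: "4 \<le> card S" by linarith
  have finS: "finite S" using S_sub finite_V finite_subset by blast
  define \<phi> where "\<phi> s = (chi E (cluster s), chi E (defect s))" for s
  have \<phi>: "\<phi> s \<in> {..m} \<times> {..m}" if s: "s \<in> S" for s
  proof -
    obtain t where t: "t \<in> S" "t \<noteq> s" using ex_fresh[OF card, of s s s] by blast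
    then have "t \<in> V" "t \<notin> cluster s" using S_sub cluster_disjoint[of s t] s self_in_cluster by blast+
    moreover have "t \<notin> defect s" using t by (auto simp: defect_def branched_def)
    ultimately show ?thesis
      using chi_part_le[OF cluster_sub[OF s]] chi_part_le[OF defect_sub] by (auto simp: \<phi>_def)
  qed
  obtain y where y: "card (\<phi> -` {y} \<inter> S) \<ge> 3"
  proof -
    have "\<exists>y \<in> {..m} \<times> {..m}. card (\<phi> -` {y} \<inter> S) * card ({..m} \<times> {..m}) \<ge> card S"
      using \<phi> finS by (intro pigeonhole_card) auto
    then obtain y where y: "card (\<phi> -` {y} \<inter> S) * (m + 1)\<^sup>2 \<ge> card S"
      by (auto simp: power2_eq_square)
    have "card (\<phi> -` {y} \<inter> S) \<ge> 3"
    proof (rule ccontr)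
      assume "\<not> ?thesis"
      then have "card (\<phi> -` {y} \<inter> S) * (m + 1)\<^sup>2 \<le> 2 * (m + 1)\<^sup>2"
        by (intro mult_right_mono) auto
      then show False using y big by linarith
    qed
    then show ?thesis using that by blast
  qed
  obtain T where T: "T \<subseteq> \<phi> -` {y} \<inter> S" "card T = 3"
    using obtain_subset_with_card_n[OF y] by blast
  then obtain d e f where def: "T = {d, e, f}" "d \<noteq> e" "d \<noteq> f" "e \<noteq> f"
    by (auto simp: card_3_iff)
  then show False
    using no_three_alike[OF card, of d e f] T by (auto simp: \<phi>_def)
qed

end

section \<open>Bounding the order\<close>

lemma clique_card_le:
  assumes "critical_graph V E m" and K: "K \<subseteq> V" "\<And>u v. u \<in> K \<Longrightarrow> v \<in> K \<Longrightarrow> u \<noteq> v \<Longrightarrow> E u v"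
  shows "card K \<le> m + 1"
proof (cases "K = {}")
  case False
  then obtain v where v: "v \<in> K" by blast
  then obtain c where c: "proper_on E (V - {v}) c" "c ` (V - {v}) \<subseteq> {..<m}"
    using critical_graph.delete_colourable[OF assms(1)] K(1) unfolding colourable_def by blast
  have "inj_on c (K - {v})"
    using proper_onD[OF c(1)] K by (intro inj_onI) blast
  moreover have "c ` (K - {v}) \<subseteq> {..<m}"
    using c(2) K(1) by blast
  ultimately have "card (K - {v}) \<le> card {..<m}"
    by (rule card_inj_on_le) simp
  moreover have "finite K"
    using K(1) assms(1) by (auto simp: critical_graph_def simple_graph_def intro: finite_subset)
  ultimately show ?thesis
    using v by simp
qed simp

text \<open>
  Ramsey's theorem: a large graph has a large clique, which criticality excludes, or a large
  independent set, which remains large when extended to a maximal one.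
\<close>

lemma order_bounded:
  obtains N where "\<And>(V :: 'a set) E. critical_graph V E m \<Longrightarrow> co_gem_dart_free V E \<Longrightarrow> card V \<le> N"
proof -
  define n where "n = 2 * (m + 1)\<^sup>2 + 2"
  obtain r where r: "\<forall>(V :: 'a set) F. finite V \<and> r \<le> card V \<longrightarrow>
      (\<exists>R \<subseteq> V. card R = m + 2 \<and> clique R F \<or> card R = n \<and> indep R F)"
    using ramsey2[of "m + 2" n] by (elim exE conjE)
  show ?thesis
  proof (rule that[of r], rule ccontr)
    fix V :: "'a set" and E
    assume crit: "critical_graph V E m" and free: "co_gem_dart_free V E" and "\<not> card V \<le> r"
    interpret critical_graph V E m by (rule crit)
    interpret co_gem_dart_free V E by (rule free)
    define F where "F = {{u, v} | u v. E u v}"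
    have F: "{u, v} \<in> F \<longleftrightarrow> E u v" for u v
      using adj_sym by (auto simp: F_def doubleton_eq_iff)
    obtain R where R: "R \<subseteq> V" "card R = m + 2 \<and> clique R F \<or> card R = n \<and> indep R F"
      using r[rule_format, of V F] finite_V \<open>\<not> card V \<le> r\<close> by auto
    have "\<not> (card R = m + 2 \<and> clique R F)"
    proof
      assume K: "card R = m + 2 \<and> clique R F"
      then have "E u v" if "u \<in> R" "v \<in> R" "u \<noteq> v" for u v
        using that F by (simp add: clique_def)
      then show False using clique_card_le[OF crit R(1)] K by simp
    qed
    then have R': "card R = n" "indep R F"
      using R(2) by blast+
    then have R_indep: "\<not> E u v" if "u \<in> R" "v \<in> R" for u v
      using that loopfree[of v] by (cases "u = v") (simp_all add: indep_def F)
    define \<I> where "\<I> = {I. I \<subseteq> V \<and> (\<forall>u \<in> I. \<forall>v \<in> I. \<not> E u v)}"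
    have "finite \<I>"
      using finite_V by (auto simp: \<I>_def intro: finite_subset[of _ "Pow V"])
    moreover have "R \<in> \<I>" using R(1) R_indep by (auto simp: \<I>_def)
    ultimately obtain S where S: "S \<in> \<I>" "R \<subseteq> S" and max: "\<And>I. I \<in> \<I> \<Longrightarrow> S \<subseteq> I \<Longrightarrow> S = I"
      using finite_has_maximal2[of \<I> R] by blast
    interpret critical_co_gem_dart_free V E m S
    proof unfold_locales
      fix x assume x: "x \<in> V" "x \<notin> S"
      show "\<exists>s \<in> S. E x s"
      proof (rule ccontr)
        assume "\<not> ?thesis"
        then have "insert x S \<in> \<I>"
          using S(1) x(1) loopfree adj_sym by (auto simp: \<I>_def)
        then show False using max x(2) by blast
      qed
    qed (use S(1) in \<open>auto simp: \<I>_def\<close>)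
    have "card R \<le> card S"
      using S S_sub finite_V by (meson card_mono finite_subset)
    then show False
      using card_independent_le R'(1) by (simp add: n_def)
  qed
qed

section \<open>Isomorphism of digraphs without parallel arcs\<close>

text \<open>
  Without parallel arcs the ends determine the arc, so a bijection of the vertices that
  respects adjacency carries the arcs along.
\<close>

lemma digraph_isoI:
  assumes G: "nomulti_digraph G" and H: "nomulti_digraph H"
    and h: "bij_betw h (verts G) (verts H)"
    and ends: "\<And>u v. u \<in> verts G \<Longrightarrow> v \<in> verts G \<Longrightarrow>
      (u, v) \<in> arcs_ends G \<longleftrightarrow> (h u, h v) \<in> arcs_ends H"
  shows "digraph_iso G H"
proof -
  interpret G: nomulti_digraph G by (rule G)
  interpret H: nomulti_digraph H by (rule H)
  define \<alpha> where "\<alpha> a = the_inv_into (arcs H) (arc_to_ends H) (h (tail G a), h (head G a))" for a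
  define hom where "hom = \<lparr> iso_verts = h, iso_arcs = \<alpha>, iso_head = head H, iso_tail = tail H \<rparr>"
  have inj_h: "inj_on h (verts G)" and img_h: "h ` verts G = verts H"
    using h by (auto simp: bij_betw_def)
  have \<alpha>: "\<alpha> a \<in> arcs H \<and> arc_to_ends H (\<alpha> a) = (h (tail G a), h (head G a))"
    if a: "a \<in> arcs G" for a
  proof -
    have "(h (tail G a), h (head G a)) \<in> arc_to_ends H ` arcs H"
      using ends[of "tail G a" "head G a"] a by (auto simp: arcs_ends_def arc_to_ends_def)
    then show ?thesis
      unfolding \<alpha>_def using H.inj_on_arc_to_ends
      by (auto intro: the_inv_into_into f_the_inv_into_f)
  qed
  have inj_\<alpha>: "inj_on \<alpha> (arcs G)"
  proof (rule inj_onI)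
    fix a b assume ab: "a \<in> arcs G" "b \<in> arcs G" "\<alpha> a = \<alpha> b"
    then have "h (tail G a) = h (tail G b)" "h (head G a) = h (head G b)"
      using \<alpha>[of a] \<alpha>[of b] by auto
    then have "arc_to_ends G a = arc_to_ends G b"
      using ab inj_onD[OF inj_h] by (auto simp: arc_to_ends_def)
    then show "a = b" using G.no_multi_arcs ab by blast
  qed
  have img_\<alpha>: "\<alpha> ` arcs G = arcs H"
  proof
    show "\<alpha> ` arcs G \<subseteq> arcs H" using \<alpha> by blast
    show "arcs H \<subseteq> \<alpha> ` arcs G"
    proof
      fix b assume b: "b \<in> arcs H"
      then obtain u v where uv: "u \<in> verts G" "v \<in> verts G" "tail H b = h u" "head H b = h v"
        using img_h by (metis H.tail_in_verts H.head_in_verts imageE)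
      have "(h u, h v) \<in> arcs_ends H"
        using b uv by (force simp: arcs_ends_def arc_to_ends_def)
      then obtain a where a: "a \<in> arcs G" "tail G a = u" "head G a = v"
        using ends[OF uv(1,2)] by (auto simp: arcs_ends_def arc_to_ends_def)
      then have "arc_to_ends H (\<alpha> a) = arc_to_ends H b"
        using \<alpha>[OF a(1)] uv by (simp add: arc_to_ends_def)
      then have "\<alpha> a = b" using H.no_multi_arcs \<alpha>[OF a(1)] b by blast
      then show "b \<in> \<alpha> ` arcs G" using a(1) by blast
    qed
  qed
  have "G.digraph_isomorphism hom"
    using \<alpha> inj_h inj_\<alpha> G.wf_digraph
    by (auto simp: G.digraph_isomorphism_def hom_def arc_to_ends_def)
  moreover have "H = app_iso hom G"
    using img_h img_\<alpha> by (intro pre_digraph.equality) (auto simp: hom_def)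
  ultimately show ?thesis unfolding digraph_iso_def by blast
qed

text \<open>
  Numbering the vertices turns each digraph into a relation on an initial segment of the
  natural numbers. There are finitely many such relations of bounded size, and the relation
  together with the number of vertices determines the isomorphism class.
\<close>

lemma finite_iso_classes:
  assumes fin: "\<And>G. G \<in> \<G> \<Longrightarrow> fin_digraph G" and nomulti: "\<And>G. G \<in> \<G> \<Longrightarrow> nomulti_digraph G"
    and bound: "\<And>G. G \<in> \<G> \<Longrightarrow> card (verts G) \<le> N"
  shows "finite (\<G> // {(G, H). digraph_iso G H})"
proof -
  let ?r = "{(G, H). digraph_iso G H}"
  have "\<exists>h. bij_betw h (verts G) {..<card (verts G)}" if "G \<in> \<G>" for G
    using fin_digraph.finite_verts[OF fin[OF that]] ex_bij_betw_finite_nat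
    by (auto simp: atLeast0LessThan)
  then obtain h where h: "\<And>G. G \<in> \<G> \<Longrightarrow> bij_betw (h G) (verts G) {..<card (verts G)}"
    by metis
  define code where
    "code G = (card (verts G), (\<lambda>(u, v). (h G u, h G v)) ` arcs_ends G)" for G
  have code_range: "code ` \<G> \<subseteq> {..N} \<times> Pow ({..<N} \<times> {..<N})"
  proof (rule image_subsetI)
    fix G assume G: "G \<in> \<G>"
    interpret fin_digraph G by (rule fin[OF G])
    have "h G u < N" if "u \<in> verts G" for u
      using bij_betwE[OF h[OF G]] bound[OF G] that by fastforce
    then show "code G \<in> {..N} \<times> Pow ({..<N} \<times> {..<N})"
      using bound[OF G] by (auto simp: code_def arcs_ends_def arc_to_ends_def)
  qed
  have same_class: "?r `` {G} = ?r `` {H}" if G: "G \<in> \<G>" and H: "H \<in> \<G>" and "code G = code H" for G H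
  proof -
    interpret G: nomulti_digraph G by (rule nomulti[OF G])
    interpret H: nomulti_digraph H by (rule nomulti[OF H])
    have card: "card (verts G) = card (verts H)"
      and ends: "(\<lambda>(u, v). (h G u, h G v)) ` arcs_ends G = (\<lambda>(u, v). (h H u, h H v)) ` arcs_ends H"
      using \<open>code G = code H\<close> by (auto simp: code_def)
    let ?f = "the_inv_into (verts H) (h H) \<circ> h G"
    have bG: "bij_betw (h G) (verts G) {..<card (verts H)}" using h[OF G] card by simp
    have bH: "bij_betw (h H) (verts H) {..<card (verts H)}" by (rule h[OF H])
    have f: "bij_betw ?f (verts G) (verts H)"
      by (rule bij_betw_trans[OF bG bij_betw_the_inv_into[OF bH]])
    have hf: "h H (?f u) = h G u" if "u \<in> verts G" for u
      using that bG bH by (auto simp: bij_betw_def intro!: f_the_inv_into_f)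
    have code_iff: "(h K u, h K v) \<in> (\<lambda>(u, v). (h K u, h K v)) ` arcs_ends K \<longleftrightarrow> (u, v) \<in> arcs_ends K"
      if K: "K \<in> \<G>" and uv: "u \<in> verts K" "v \<in> verts K" for K u v
    proof
      interpret wf_digraph K using fin[OF K] by (simp add: fin_digraph_def)
      assume "(h K u, h K v) \<in> (\<lambda>(u, v). (h K u, h K v)) ` arcs_ends K"
      then obtain u' v' where "(u', v') \<in> arcs_ends K" "h K u = h K u'" "h K v = h K v'"
        by auto
      moreover have "u' \<in> verts K" "v' \<in> verts K"
        using calculation(1) by (auto simp: arcs_ends_def arc_to_ends_def)
      ultimately show "(u, v) \<in> arcs_ends K"
        using h[OF K] uv by (metis bij_betw_inv_into_left)
    qed (rule rev_image_eqI, auto)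
    have "digraph_iso G H"
    proof (rule digraph_isoI[OF G.nomulti_digraph H.nomulti_digraph f])
      fix u v assume uv: "u \<in> verts G" "v \<in> verts G"
      have "?f u \<in> verts H" "?f v \<in> verts H" using f uv bij_betwE by blast+
      then show "(u, v) \<in> arcs_ends G \<longleftrightarrow> (?f u, ?f v) \<in> arcs_ends H"
        using code_iff[OF G uv] code_iff[OF H, of "?f u" "?f v"] hf[OF uv(1)] hf[OF uv(2)] ends
        by simp
    qed
    then show ?thesis
      using digraph_iso_swap[OF G.wf_digraph] digraph_iso_trans by blast
  qed
  have "finite (code ` \<G>)"
    by (rule finite_subset[OF code_range]) simp
  moreover have "\<G> // ?r \<subseteq> (\<lambda>k. ?r `` {SOME G. G \<in> \<G> \<and> code G = k}) ` code ` \<G>"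
  proof
    fix X assume "X \<in> \<G> // ?r"
    then obtain G where G: "G \<in> \<G>" "X = ?r `` {G}" by (auto elim: quotientE)
    let ?H = "SOME H. H \<in> \<G> \<and> code H = code G"
    have "?H \<in> \<G> \<and> code ?H = code G"
      by (rule someI[of _ G]) (use G in simp)
    then have "X = ?r `` {?H}"
      using same_class[OF G(1), of ?H] G(2) by simp
    then show "X \<in> (\<lambda>k. ?r `` {SOME G. G \<in> \<G> \<and> code G = k}) ` code ` \<G>"
      using G(1) by blast
  qed
  ultimately show ?thesis by (meson finite_imageI finite_subset)
qed

text \<open>
  A list of vertices of $G$ serves as an embedding of a graph whose vertices are $0,\dots,n-1$.
\<close>

lemma not_induced_freeI:
  assumes G: "nomulti_digraph G" and xs: "distinct xs" "set xs \<subseteq> verts G"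
    and H: "pverts H = {..<length xs}" "parcs H \<subseteq> pverts H \<times> pverts H"
    and ends: "\<And>i j. i < length xs \<Longrightarrow> j < length xs \<Longrightarrow>
      (xs ! i, xs ! j) \<in> arcs_ends G \<longleftrightarrow> (i, j) \<in> parcs H"
  shows "\<not> induced_free (with_proj H) G"
proof -
  interpret G: nomulti_digraph G by (rule G)
  let ?G' = "G \<restriction> set xs"
  have wf_H: "nomulti_digraph (with_proj H)"
    using H(2) by unfold_locales (auto simp: arc_to_ends_def)
  interpret G': wf_digraph ?G' by (rule G.wellformed_induce_subgraph)
  have "nomulti_digraph ?G'"
    using G.no_multi_arcs by unfold_locales auto
  moreover have "bij_betw ((!) xs) (verts (with_proj H)) (verts ?G')"
    using xs(1) H(1) by (auto intro: bij_betw_nth)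
  moreover have "(i, j) \<in> arcs_ends (with_proj H) \<longleftrightarrow> (xs ! i, xs ! j) \<in> arcs_ends ?G'"
    if "i \<in> verts (with_proj H)" "j \<in> verts (with_proj H)" for i j
  proof -
    have "i < length xs" "j < length xs" using that H(1) by simp_all
    moreover have "(u, v) \<in> arcs_ends ?G' \<longleftrightarrow> (u, v) \<in> arcs_ends G \<and> u \<in> set xs \<and> v \<in> set xs" for u v
      by (auto simp: arcs_ends_conv image_iff)
    ultimately show ?thesis using ends[of i j] by simp
  qed
  ultimately have "digraph_iso (with_proj H) ?G'"
    by (intro digraph_isoI[OF wf_H])
  then have "digraph_iso ?G' (with_proj H)"
    using digraph_iso_swap wf_H nomulti_digraph.axioms(1) by blast
  then show ?thesis
    using G.induced_induce[OF xs(2)] unfolding induced_free_def by blast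
qed

section \<open>Transfer to symmetric digraphs\<close>

lemma less_5_iff: "i < 5 \<longleftrightarrow> i = 0 \<or> i = 1 \<or> i = 2 \<or> i = 3 \<or> i = (4 :: nat)"
  by auto

lemma parcs_co_gem: "parcs co_gem = {(0, 1), (1, 0), (1, 2), (2, 1), (2, 3), (3, 2)}"
  by (auto simp: co_gem_def mk_symmetric_def)

lemma pverts_co_gem: "pverts co_gem = {..<5}"
  by (auto simp: co_gem_def mk_symmetric_def less_5_iff)

lemma parcs_co_gem_subset: "parcs co_gem \<subseteq> pverts co_gem \<times> pverts co_gem"
  by (simp add: parcs_co_gem pverts_co_gem)

lemma parcs_dart: "parcs dart = {(0, 1), (1, 0), (0, 2), (2, 0), (1, 2), (2, 1), (1, 3), (3, 1),
    (2, 3), (3, 2), (1, 4), (4, 1)}"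
  by (auto simp: dart_def mk_symmetric_def)

lemma pverts_dart: "pverts dart = {..<5}"
  by (auto simp: dart_def mk_symmetric_def less_5_iff)

lemma parcs_dart_subset: "parcs dart \<subseteq> pverts dart \<times> pverts dart"
  by (simp add: parcs_dart pverts_dart)

lemma simple_graph_of_graph:
  assumes "graph G"
  shows "simple_graph (verts G) (\<lambda>u v. (u, v) \<in> arcs_ends G)"
proof -
  interpret graph G by (rule assms)
  show ?thesis
  proof unfold_locales
    show "(u, v) \<in> arcs_ends G \<Longrightarrow> u \<in> verts G" for u v
      by (auto simp: arcs_ends_conv)
  qed (use adj_not_same arcs_ends_symmetric[OF sym_arcs] in auto)
qed

lemma co_gem_dart_free_of_graph:
  assumes G: "graph G"
    and co_gem: "induced_free (with_proj co_gem) G" and dart: "induced_free (with_proj dart) G"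
  shows "co_gem_dart_free (verts G) (\<lambda>u v. (u, v) \<in> arcs_ends G)"
proof -
  interpret graph G by (rule G)
  interpret simple_graph "verts G" "\<lambda>u v. (u, v) \<in> arcs_ends G"
    by (rule simple_graph_of_graph[OF G])
  have sym: "(u, v) \<in> arcs_ends G \<longleftrightarrow> (v, u) \<in> arcs_ends G" for u v
    using adj_sym by blast
  show ?thesis
  proof unfold_locales
    fix a b c d z
    assume adj: "(a, b) \<in> arcs_ends G" "(b, c) \<in> arcs_ends G" "(c, d) \<in> arcs_ends G"
      and nadj: "(a, c) \<notin> arcs_ends G" "(a, d) \<notin> arcs_ends G" "(b, d) \<notin> arcs_ends G"
      and z: "z \<in> verts G" "(z, a) \<notin> arcs_ends G" "(z, b) \<notin> arcs_ends G"
        "(z, c) \<notin> arcs_ends G" "(z, d) \<notin> arcs_ends G"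
    have adj': "(b, a) \<in> arcs_ends G" "(c, b) \<in> arcs_ends G" "(d, c) \<in> arcs_ends G"
      and nadj': "(c, a) \<notin> arcs_ends G" "(d, a) \<notin> arcs_ends G" "(d, b) \<notin> arcs_ends G"
        "(a, z) \<notin> arcs_ends G" "(b, z) \<notin> arcs_ends G" "(c, z) \<notin> arcs_ends G" "(d, z) \<notin> arcs_ends G"
      using adj nadj z sym by blast+
    let ?xs = "[a, b, c, d, z]"
    have distinct: "distinct ?xs"
      using adj nadj z adj' nadj' loopfree by auto
    have verts: "set ?xs \<subseteq> verts G"
      using adj adj' z adj_in_V by auto
    have ends: "(?xs ! i, ?xs ! j) \<in> arcs_ends G \<longleftrightarrow> (i, j) \<in> parcs co_gem"
      if "i < length ?xs" "j < length ?xs" for i j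
    proof -
      have "i < 5" "j < 5" using that by simp_all
      then show ?thesis
        unfolding less_5_iff parcs_co_gem
        by (elim disjE) (simp_all add: adj nadj z adj' nadj' loopfree)
    qed
    have length: "pverts co_gem = {..<length ?xs}" by (simp add: pverts_co_gem)
    show False
      using not_induced_freeI[OF nomulti_digraph distinct verts length parcs_co_gem_subset ends] co_gem
      by blast
  next
    fix a b c d p
    assume adj: "(a, b) \<in> arcs_ends G" "(a, c) \<in> arcs_ends G" "(b, c) \<in> arcs_ends G"
      "(b, d) \<in> arcs_ends G" "(c, d) \<in> arcs_ends G" "(b, p) \<in> arcs_ends G"
      and "a \<noteq> d"
      and nadj: "(a, d) \<notin> arcs_ends G" "(p, a) \<notin> arcs_ends G" "(p, c) \<notin> arcs_ends G"
        "(p, d) \<notin> arcs_ends G"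
    have adj': "(b, a) \<in> arcs_ends G" "(c, a) \<in> arcs_ends G" "(c, b) \<in> arcs_ends G"
      "(d, b) \<in> arcs_ends G" "(d, c) \<in> arcs_ends G" "(p, b) \<in> arcs_ends G"
      and nadj': "(d, a) \<notin> arcs_ends G" "(a, p) \<notin> arcs_ends G" "(c, p) \<notin> arcs_ends G"
        "(d, p) \<notin> arcs_ends G"
      using adj nadj sym by blast+
    let ?xs = "[a, b, c, d, p]"
    have distinct: "distinct ?xs"
      using adj nadj adj' nadj' loopfree \<open>a \<noteq> d\<close> by auto
    have verts: "set ?xs \<subseteq> verts G"
      using adj adj' adj_in_V by auto
    have ends: "(?xs ! i, ?xs ! j) \<in> arcs_ends G \<longleftrightarrow> (i, j) \<in> parcs dart"
      if "i < length ?xs" "j < length ?xs" for i j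
    proof -
      have "i < 5" "j < 5" using that by simp_all
      then show ?thesis
        unfolding less_5_iff parcs_dart
        by (elim disjE) (simp_all add: adj nadj adj' nadj' loopfree)
    qed
    have length: "pverts dart = {..<length ?xs}" by (simp add: pverts_dart)
    show False
      using not_induced_freeI[OF nomulti_digraph distinct verts length parcs_dart_subset ends] dart
      by blast
  qed
qed

lemma ex_proper_colouring_iff:
  assumes "wf_digraph G"
  shows "(\<exists>c. proper_colouring G j c) \<longleftrightarrow> colourable (\<lambda>u v. (u, v) \<in> arcs_ends G) (verts G) j"
proof -
  interpret wf_digraph G by (rule assms)
  have "u \<in> verts G \<and> v \<in> verts G" if "(u, v) \<in> arcs_ends G" for u v
    using that by (auto simp: arcs_ends_conv)
  then have "proper_colouring G j c \<longleftrightarrow>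
      proper_on (\<lambda>u v. (u, v) \<in> arcs_ends G) (verts G) c \<and> c ` verts G \<subseteq> {..<j}" for c
    by (auto simp: proper_colouring_def proper_on_def)
  then show ?thesis unfolding colourable_def by blast
qed

lemma colourable_le: "colourable E A i \<Longrightarrow> i \<le> j \<Longrightarrow> colourable E A j"
  unfolding colourable_def by (meson lessThan_subset_iff subset_trans)

lemma critical_graph_of_graph:
  assumes G: "graph G" and k: "k \<ge> 1" and crit: "vertex_critical k G"
  shows "critical_graph (verts G) (\<lambda>u v. (u, v) \<in> arcs_ends G) (k - 1)"
proof -
  interpret graph G by (rule G)
  let ?E = "\<lambda>u v. (u, v) \<in> arcs_ends G"
  interpret simple_graph "verts G" ?E
    by (rule simple_graph_of_graph[OF G])
  show ?thesis
  proof unfold_locales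
    have "chromatic_number G = k" using crit by (simp add: vertex_critical_def)
    then have "\<not> (\<exists>c. proper_colouring G (k - 1) c)"
      using k not_less_Least[of "k - 1" "\<lambda>j. \<exists>c. proper_colouring G j c"]
      by (simp add: chromatic_number_def)
    then show "\<not> colourable ?E (verts G) (k - 1)"
      using ex_proper_colouring_iff[OF wf_digraph] by blast
  next
    fix v assume v: "v \<in> verts G"
    let ?D = "del_vert v"
    have ends: "(x, y) \<in> arcs_ends ?D \<longleftrightarrow> (x, y) \<in> arcs_ends G \<and> x \<noteq> v \<and> y \<noteq> v" for x y
      by (auto simp: arcs_ends_conv del_vert_simps)
    have iff: "(\<exists>c. proper_colouring ?D j c) \<longleftrightarrow> colourable ?E (verts G - {v}) j" for j
      unfolding ex_proper_colouring_iff[OF wf_digraph_del_vert]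
      by (auto simp: colourable_def proper_on_def ends del_vert_simps)
    obtain i :: "'a \<Rightarrow> nat" where "inj_on i (verts G - {v})"
      using finite_imp_inj_to_nat_seg[of "verts G - {v}"] by auto
    then have "proper_on ?E (verts G - {v}) i"
      unfolding proper_on_def using loopfree inj_onD by metis
    then have "\<exists>j. colourable ?E (verts G - {v}) j"
      using colourable_card_colours[of "verts G - {v}"] by auto
    then have "colourable ?E (verts G - {v}) (chromatic_number ?D)"
      unfolding chromatic_number_def iff by (rule LeastI_ex)
    moreover have "chromatic_number ?D \<le> k - 1"
      using crit v unfolding vertex_critical_def by fastforce
    ultimately show "colourable ?E (verts G - {v}) (k - 1)"
      by (rule colourable_le)
  qed
qed

theorem theorem2:
  fixes k :: nat
  assumes "k \<ge> 1"
  shows "finite ({G :: ('a, 'b) pre_digraph. graph G \<and> vertex_critical k G \<and>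
                    induced_free (with_proj co_gem) G \<and> induced_free (with_proj dart) G}
                 // {(G, H). digraph_iso G H})"
proof -
  obtain N where N: "\<And>(V :: 'a set) E. critical_graph V E (k - 1) \<Longrightarrow> co_gem_dart_free V E \<Longrightarrow> card V \<le> N"
    using order_bounded by blast
  show ?thesis
  proof (rule finite_iso_classes[of _ N]; clarify)
    fix G :: "('a, 'b) pre_digraph"
    assume G: "graph G" and crit: "vertex_critical k G"
      and free: "induced_free (with_proj co_gem) G" "induced_free (with_proj dart) G"
    interpret graph G by (rule G)
    show "fin_digraph G" "nomulti_digraph G" by unfold_locales
    show "card (verts G) \<le> N"
      using N critical_graph_of_graph[OF G assms crit] co_gem_dart_free_of_graph[OF G free] by blast
  qed
qed

end
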